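(* Given any finite Markov decision process $(\mathcal S,\mathcal A,p,r,\hat{\boldsymbol p})$ with horizon $T=1$ and any $\alpha\in[0,1]$, $$\max_{\pi\in\Pi}\ Q_\alpha^{\tilde a\sim\boldsymbol\pi(\tilde s)}\big(r(\tilde s,\tilde a,\tilde s')\big)=\sup_{\boldsymbol\zeta\in[0,1]^S}\Big\{\min_{s\in\mathcal S:\ \zeta_s<1}\ \max_{\boldsymbol d\in\Delta_A}\ Q_{\zeta_s}^{\tilde a\sim\boldsymbol d}\big(r(s,\tilde a,\tilde s')\mid\tilde s=s\big)\ \Big|\ \sum_{s\in\mathcal S}\zeta_s\hat p_s<\alpha\Big\}.$$
   Context: A finite MDP with horizon $T=1$ consists of a finite state set $\mathcal S$ with $S=|\mathcal S|$, a finite action set $\mathcal A$ with $A=|\mathcal A|$, a transition function $p$ where $p(s,a,\cdot)$ is a probability distribution on $\mathcal S$ for each $(s,a)$, a reward function $r:\mathcal S\times\mathcal A\times\mathcal S\to\mathbb R$, and an initial distribution $\hat{\boldsymbol p}$ on $\mathcal S$ with $\hat p_s>0$ for every $s\in\mathcal S$. $\Delta_A$ is the set of probability vectors indexed by $\mathcal A$. $\Pi$ is the set of randomized policies $\boldsymbol\pi:\mathcal S\to\Delta_A$. The random variables are: $\tilde s\sim\hat{\boldsymbol p}$; the action $\tilde a$, distributed according to $\boldsymbol\pi(\tilde s)$ given $\tilde s$ (superscript $\tilde a\sim\boldsymbol\pi(\tilde s)$), or according to $\boldsymbol d$ (superscript $\tilde a\sim\boldsymbol d$); and $\tilde s'\sim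 p(\tilde s,\tilde a,\cdot)$ given $(\tilde s,\tilde a)$. "$\mid\tilde s=s$" means evaluation under the conditional distribution given $\tilde s=s$. For a real random variable $\tilde x$ on a finite probability space and $\alpha\in[0,1]$, the lower quantile is $Q_\alpha(\tilde x)=\inf\{z\in\mathbb R\mid\mathbb P[\tilde x\le z]\ge\alpha\}$, with values in the extended reals (so $Q_0(\tilde x)=-\infty$). The supremum over an empty feasible set (which only occurs if $\alpha=0$) is interpreted as $-\infty$. *)

theory Defs
  imports "HOL-Probability.Probability"
begin

text \<open>
  The infimum is taken in the extended reals, but only over real thresholds; hence the
  quantile at level 0 is \<open>-\<infinity>\<close>.
\<close>

definition lower_quantile :: "real \<Rightarrow> 'w pmf \<Rightarrow> ('w \<Rightarrow> real) \<Rightarrow> ereal" where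
  "lower_quantile \<alpha> M X = (INF z\<in>{z::real. measure_pmf.prob M {\<omega>. X \<omega> \<le> z} \<ge> \<alpha>}. ereal z)"

text \<open>
  State and action sets are finite types, and \<open>\<Delta>\<^sub>A\<close> is represented by the type of pmfs on
  actions; thus every function \<open>'s \<Rightarrow> 'a pmf\<close> is a randomized policy.
  \<open>episode p0 p \<pi>\<close> is the joint law of the initial state, the action and the next state.
\<close>

definition episode ::
  "'s pmf \<Rightarrow> ('s \<Rightarrow> 'a \<Rightarrow> 's pmf) \<Rightarrow> ('s \<Rightarrow> 'a pmf) \<Rightarrow> ('s \<times> 'a \<times> 's) pmf" where
  "episode p0 p \<pi> =
     bind_pmf p0 (\<lambda>s. bind_pmf (\<pi> s) (\<lambda>a. bind_pmf (p s a) (\<lambda>s'. return_pmf (s, a, s'))))"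

definition policy_quantile ::
  "'s pmf \<Rightarrow> ('s \<Rightarrow> 'a \<Rightarrow> 's pmf) \<Rightarrow> ('s \<Rightarrow> 'a \<Rightarrow> 's \<Rightarrow> real) \<Rightarrow> real \<Rightarrow> ('s \<Rightarrow> 'a pmf) \<Rightarrow> ereal" where
  "policy_quantile p0 p r \<alpha> \<pi> =
     lower_quantile \<alpha> (episode p0 p \<pi>) (\<lambda>(s, a, s'). r s a s')"

text \<open>
  The law is conditioned on the initial state being \<open>s\<close>, which requires \<open>s\<close> to have positive
  probability under \<open>p0\<close>.
\<close>

definition state_quantile ::
  "'s pmf \<Rightarrow> ('s \<Rightarrow> 'a \<Rightarrow> 's pmf) \<Rightarrow> ('s \<Rightarrow> 'a \<Rightarrow> 's \<Rightarrow> real) \<Rightarrow> real \<Rightarrow> 's \<Rightarrow> 'a pmf \<Rightarrow> ereal" where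
  "state_quantile p0 p r \<alpha> s d =
     lower_quantile \<alpha> (cond_pmf (episode p0 p (\<lambda>_. d)) {\<omega>. fst \<omega> = s}) (\<lambda>(_, a, s'). r s a s')"

definition feasible_levels :: "'s::finite pmf \<Rightarrow> real \<Rightarrow> ('s \<Rightarrow> real) set" where
  "feasible_levels p0 \<alpha> =
     {\<zeta>. (\<forall>s. \<zeta> s \<in> {0..1}) \<and> (\<Sum>s\<in>UNIV. \<zeta> s * pmf p0 s) < \<alpha>}"

end

theory Submission
  imports Defs
begin

text \<open>
  Both sides are compared through their real lower bounds. A random variable with finitely many
  values has lower \<open>\<alpha>\<close>-quantile at least \<open>v\<close> exactly when it falls strictly below \<open>v\<close> with
  probability less than \<open>\<alpha>\<close> (\<open>le_lower_quantile_iff\<close>). This turns every quantile into a probability,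
  and probabilities decompose over the initial state: if \<open>F s d\<close> denotes the probability that the
  reward from \<open>s\<close> under the action law \<open>d\<close> is below \<open>v\<close> (\<open>shortfall\<close>), then a policy \<open>\<pi>\<close> has quantile
  at least \<open>v\<close> iff the \<open>p0\<close>-average of \<open>F s (\<pi> s)\<close> is less than \<open>\<alpha>\<close>, while the conditional quantile at
  level \<open>\<zeta> s\<close> is at least \<open>v\<close> iff \<open>F s d < \<zeta> s\<close>.

  The levels \<open>\<zeta>\<close> are a budget that allots the total probability \<open>\<alpha>\<close> of falling below \<open>v\<close> to the states.
  A policy whose average is less than \<open>\<alpha>\<close> leaves some slack, and raising each \<open>F s (\<pi> s)\<close> by half of
  it (truncated at 1) gives a feasible budget. Conversely, action laws that respect a feasible
  budget state by state form a policy whose average is less than \<open>\<alpha>\<close>; at states with \<open>\<zeta> s = 1\<close> there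
  is nothing to respect, which is why the minimum leaves them out
  (\<open>ex_policy_iff_ex_feasible_levels\<close>).

  This equivalence concerns the existence of a policy or action law whose quantile is at least \<open>v\<close>.
  It speaks about suprema because they are attained: the quantiles of one random variable under all
  laws lie in a finite set (\<open>lower_quantile_SUP_attained\<close>).
\<close>

section \<open>Lower quantiles of random variables with finitely many values\<close>

text \<open>
  Since \<open>X\<close> has finitely many values, the event \<open>X < v\<close> coincides with \<open>X \<le> m\<close> for some \<open>m < v\<close>. So if
  it has probability at least \<open>\<alpha>\<close>, the threshold \<open>m\<close> already pushes the quantile below \<open>v\<close>.
\<close>

lemma le_lower_quantile_iff:
  fixes X :: "'w \<Rightarrow> real"
  assumes "finite (range X)"
  shows "ereal v \<le> lower_quantile \<alpha> M X \<longleftrightarrow> measure_pmf.prob M {\<omega>. X \<omega> < v} < \<alpha>"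
proof
  assume le: "ereal v \<le> lower_quantile \<alpha> M X"
  \<comment> \<open>The element \<open>v - 1\<close> provides for the case that no value of \<open>X\<close> is below \<open>v\<close>.\<close>
  define m where "m = Max (insert (v - 1) {x \<in> range X. x < v})"
  have fin: "finite {x \<in> range X. x < v}"
    using assms by simp
  then have "m < v"
    unfolding m_def by (subst Max_less_iff) auto
  have "x \<le> m" if "x \<in> range X" "x < v" for x
    unfolding m_def using fin that by (intro Max_ge) auto
  then have "{\<omega>. X \<omega> < v} = {\<omega>. X \<omega> \<le> m}"
    using \<open>m < v\<close> by fastforce
  moreover have "\<not> \<alpha> \<le> measure_pmf.prob M {\<omega>. X \<omega> \<le> m}"
  proof
    assume "\<alpha> \<le> measure_pmf.prob M {\<omega>. X \<omega> \<le> m}"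
    then have "lower_quantile \<alpha> M X \<le> ereal m"
      unfolding lower_quantile_def by (intro INF_lower) simp
    with le have "ereal v \<le> ereal m"
      by (rule order_trans)
    with \<open>m < v\<close> show False by simp
  qed
  ultimately show "measure_pmf.prob M {\<omega>. X \<omega> < v} < \<alpha>"
    by simp
next
  assume less: "measure_pmf.prob M {\<omega>. X \<omega> < v} < \<alpha>"
  have "v \<le> z" if "\<alpha> \<le> measure_pmf.prob M {\<omega>. X \<omega> \<le> z}" for z
  proof (rule ccontr)
    assume "\<not> v \<le> z"
    then have "measure_pmf.prob M {\<omega>. X \<omega> \<le> z} \<le> measure_pmf.prob M {\<omega>. X \<omega> < v}"
      by (intro measure_pmf.finite_measure_mono) auto
    with that less show False by simp
  qed
  then show "ereal v \<le> lower_quantile \<alpha> M X"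
    unfolding lower_quantile_def by (intro INF_greatest) simp
qed

text \<open>
  The law of \<open>X\<close> puts no mass strictly between consecutive values of \<open>X\<close>. If the quantile were a real
  number \<open>q\<close> that is not a value, the next value above \<open>q\<close> would still be a lower bound for it.
\<close>

lemma lower_quantile_in_range:
  fixes X :: "'w \<Rightarrow> real"
  assumes "finite (range X)"
  shows "lower_quantile \<alpha> M X \<in> {-\<infinity>, \<infinity>} \<union> ereal ` range X"
proof (cases "lower_quantile \<alpha> M X")
  case (real q)
  have "q \<in> range X"
  proof (rule ccontr)
    assume q: "q \<notin> range X"
    \<comment> \<open>The element \<open>q + 1\<close> provides for the case that no value of \<open>X\<close> is above \<open>q\<close>.\<close>
    define w where "w = Min (insert (q + 1) {x \<in> range X. q < x})"
    have fin: "finite {x \<in> range X. q < x}"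
      using assms by simp
    then have "q < w"
      unfolding w_def by (subst Min_gr_iff) auto
    have "w \<le> x" if "x \<in> range X" "q < x" for x
      unfolding w_def using fin that by (intro Min_le) auto
    then have "{\<omega>. X \<omega> < w} = {\<omega>. X \<omega> < q}"
      using \<open>q < w\<close> q by (intro Collect_cong) (metis less_trans linorder_neqE not_less rangeI)
    then have "ereal w \<le> lower_quantile \<alpha> M X"
      using le_lower_quantile_iff[OF assms, of q \<alpha> M] le_lower_quantile_iff[OF assms, of w \<alpha> M]
      by (simp add: real)
    with \<open>q < w\<close> show False by (simp add: real)
  qed
  then show ?thesis by (simp add: real)
qed simp_all

text \<open>
  The finite set of possible quantiles does not depend on the law, so a supremum over any family of
  laws is a maximum, even though the families of policies and action laws are infinite.
\<close>

lemma lower_quantile_SUP_attained: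
  fixes X :: "'w \<Rightarrow> real"
  assumes "finite (range X)"
  shows "\<exists>i. lower_quantile \<alpha> (M i) X = (SUP i. lower_quantile \<alpha> (M i) X)"
proof -
  let ?Q = "\<lambda>i. lower_quantile \<alpha> (M i) X"
  have "range ?Q \<subseteq> {-\<infinity>, \<infinity>} \<union> ereal ` range X"
    using lower_quantile_in_range[OF assms] by blast
  then have "finite (range ?Q)"
    by (rule finite_subset) (use assms in simp)
  then have "Max (range ?Q) \<in> range ?Q" "Sup (range ?Q) = Max (range ?Q)"
    by (simp, intro Max_Sup[symmetric]) auto
  then show ?thesis by (metis (no_types, lifting) imageE)
qed

lemma ereal_leI_real_below:
  fixes x y :: ereal
  assumes "\<And>v. ereal v \<le> x \<Longrightarrow> ereal v \<le> y"
  shows "x \<le> y"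
proof (rule ccontr)
  assume "\<not> x \<le> y"
  then obtain v where "y < ereal v" "ereal v < x"
    using ereal_dense2 by (meson not_le)
  with assms[of v] show False by (meson leD less_imp_le)
qed

section \<open>Quantiles of the reward as conditions on the shortfall\<close>

lemma prob_bind_pmf_finite:
  fixes M :: "'x::finite pmf" and f :: "'x \<Rightarrow> 'y pmf"
  shows "measure_pmf.prob (bind_pmf M f) E = (\<Sum>x\<in>UNIV. pmf M x * measure_pmf.prob (f x) E)"
proof -
  have prob_eq: "measure_pmf.prob N E = pmf (map_pmf (\<lambda>y. y \<in> E) N) True" for N :: "'y pmf"
    by (simp add: pmf_map vimage_def)
  have "measure_pmf.prob (bind_pmf M f) E = (\<integral>x. measure_pmf.prob (f x) E \<partial>M)"
    unfolding prob_eq by (simp add: map_bind_pmf pmf_bind)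
  also have "\<dots> = (\<Sum>x\<in>UNIV. measure_pmf.prob (f x) E * pmf M x)"
    by (intro integral_measure_pmf_real) auto
  finally show ?thesis by (simp add: mult.commute)
qed

text \<open>
  For an action law \<open>d\<close> played in \<open>s\<close>, this is the conditional probability that the reward is below
  \<open>v\<close>, written as the sum in which it occurs on both sides of the theorem.
\<close>

definition shortfall ::
  "('s::finite \<Rightarrow> 'a::finite \<Rightarrow> 's pmf) \<Rightarrow> ('s \<Rightarrow> 'a \<Rightarrow> 's \<Rightarrow> real) \<Rightarrow> real \<Rightarrow> 's \<Rightarrow> 'a pmf \<Rightarrow> real"
where
  "shortfall p r v s d = (\<Sum>a\<in>UNIV. pmf d a * measure_pmf.prob (p s a) {s'. r s a s' < v})"

lemma shortfall_le_1: "shortfall p r v s d \<le> 1"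
proof -
  have "shortfall p r v s d \<le> (\<Sum>a\<in>UNIV. pmf d a * 1)"
    unfolding shortfall_def by (intro sum_mono mult_left_mono) auto
  also have "\<dots> = 1"
    by (simp add: sum_pmf_eq_1)
  finally show ?thesis .
qed

lemma shortfall_nonneg: "0 \<le> shortfall p r v s d"
  unfolding shortfall_def by (intro sum_nonneg mult_nonneg_nonneg) auto

lemma prob_episode:
  fixes p :: "'s::finite \<Rightarrow> 'a::finite \<Rightarrow> 's pmf"
  shows "measure_pmf.prob (episode p0 p \<pi>) E =
    (\<Sum>s\<in>UNIV. pmf p0 s * (\<Sum>a\<in>UNIV. pmf (\<pi> s) a * measure_pmf.prob (p s a) {s'. (s, a, s') \<in> E}))"
proof -
  have "measure_pmf.prob (bind_pmf (p s a) (\<lambda>s'. return_pmf (s, a, s'))) E =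
      measure_pmf.prob (p s a) {s'. (s, a, s') \<in> E}" for s a
    by (simp add: map_pmf_def[symmetric] vimage_def)
  then show ?thesis
    by (simp add: episode_def prob_bind_pmf_finite)
qed

lemma le_policy_quantile_iff:
  "ereal v \<le> policy_quantile p0 p r \<alpha> \<pi> \<longleftrightarrow> (\<Sum>s\<in>UNIV. pmf p0 s * shortfall p r v s (\<pi> s)) < \<alpha>"
  unfolding policy_quantile_def
  by (subst le_lower_quantile_iff) (simp_all add: prob_episode shortfall_def)

text \<open>
  Conditioning on the initial state \<open>s\<close> singles out one summand of \<open>prob_episode\<close> and divides its
  weight \<open>pmf p0 s\<close> away.
\<close>

lemma prob_conditional_episode:
  fixes p :: "'s::finite \<Rightarrow> 'a::finite \<Rightarrow> 's pmf"
  assumes "pmf p0 s > 0"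
  shows "measure_pmf.prob (cond_pmf (episode p0 p (\<lambda>_. d)) {\<omega>. fst \<omega> = s}) E =
    (\<Sum>a\<in>UNIV. pmf d a * measure_pmf.prob (p s a) {s'. (s, a, s') \<in> E})"
proof -
  let ?M = "episode p0 p (\<lambda>_. d)"
  have joint: "measure_pmf.prob ?M ({\<omega>. fst \<omega> = s} \<inter> E) =
      pmf p0 s * (\<Sum>a\<in>UNIV. pmf d a * measure_pmf.prob (p s a) {s'. (s, a, s') \<in> E})" for E
  proof -
    have "measure_pmf.prob ?M ({\<omega>. fst \<omega> = s} \<inter> E) =
        (\<Sum>t\<in>UNIV. if t = s then
           pmf p0 s * (\<Sum>a\<in>UNIV. pmf d a * measure_pmf.prob (p s a) {s'. (s, a, s') \<in> E}) else 0)"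
      unfolding prob_episode by (intro sum.cong) auto
    then show ?thesis by simp
  qed
  have start: "measure_pmf.prob ?M {\<omega>. fst \<omega> = s} = pmf p0 s"
    using joint[of UNIV] by (simp add: sum_pmf_eq_1)
  then have nonempty: "set_pmf ?M \<inter> {\<omega>. fst \<omega> = s} \<noteq> {}"
    using assms by (metis measure_Int_set_pmf Int_commute measure_empty less_irrefl)
  then show ?thesis
    using assms start joint[of E]
    by (simp add: cond_pmf.rep_eq[OF nonempty] measure_uniform_measure
        measure_pmf.emeasure_eq_measure)
qed

lemma le_state_quantile_iff:
  assumes "pmf p0 s > 0"
  shows "ereal v \<le> state_quantile p0 p r z s d \<longleftrightarrow> shortfall p r v s d < z"
  unfolding state_quantile_def
  by (subst le_lower_quantile_iff)
    (simp_all add: prob_conditional_episode[OF assms] shortfall_def)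

lemma policy_quantile_SUP_attained:
  fixes p :: "'s::finite \<Rightarrow> 'a::finite \<Rightarrow> 's pmf"
  shows "\<exists>\<pi>. policy_quantile p0 p r \<alpha> \<pi> = (SUP \<pi>'. policy_quantile p0 p r \<alpha> \<pi>')"
  unfolding policy_quantile_def
  by (rule lower_quantile_SUP_attained[where M = "episode p0 p"]) simp

lemma state_quantile_SUP_attained:
  fixes p :: "'s::finite \<Rightarrow> 'a::finite \<Rightarrow> 's pmf"
  shows "\<exists>d. state_quantile p0 p r z s d = (SUP d'. state_quantile p0 p r z s d')"
  unfolding state_quantile_def
  by (rule lower_quantile_SUP_attained
      [where M = "\<lambda>d. cond_pmf (episode p0 p (\<lambda>_. d)) {\<omega>. fst \<omega> = s}"]) simp

section \<open>Splitting the quantile level among the initial states\<close>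

lemma feasible_levels_ex_less_1:
  assumes "\<alpha> \<le> 1" "\<zeta> \<in> feasible_levels p0 \<alpha>"
  shows "{s. \<zeta> s < 1} \<noteq> {}"
proof
  assume "{s. \<zeta> s < 1} = {}"
  then have "1 \<le> \<zeta> s" for s
    by (auto simp: not_less)
  moreover have "\<zeta> s \<le> 1" for s
    using assms(2) by (simp add: feasible_levels_def)
  ultimately have "\<zeta> s = 1" for s
    by (simp add: antisym)
  then have "(\<Sum>s\<in>UNIV. \<zeta> s * pmf p0 s) = 1"
    by (simp add: sum_pmf_eq_1)
  with assms show False by (simp add: feasible_levels_def)
qed

text \<open>
  A policy is traded for a budget of levels and back. The levels cannot be the shortfalls themselves,
  since the conditional quantile at level \<open>\<zeta> s\<close> is at least \<open>v\<close> only if the shortfall is strictly below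
  \<open>\<zeta> s\<close>; there is room to raise them because the average shortfall is strictly below \<open>\<alpha>\<close>.
\<close>

lemma ex_policy_iff_ex_feasible_levels:
  fixes p :: "'s::finite \<Rightarrow> 'a::finite \<Rightarrow> 's pmf"
  assumes pos: "\<And>s. pmf p0 s > 0"
  shows "(\<exists>\<pi>. ereal v \<le> policy_quantile p0 p r \<alpha> \<pi>) \<longleftrightarrow>
    (\<exists>\<zeta>\<in>feasible_levels p0 \<alpha>. \<forall>s. \<zeta> s < 1 \<longrightarrow> (\<exists>d. ereal v \<le> state_quantile p0 p r (\<zeta> s) s d))"
  unfolding le_policy_quantile_iff le_state_quantile_iff[OF pos]
proof
  assume "\<exists>\<pi>. (\<Sum>s\<in>UNIV. pmf p0 s * shortfall p r v s (\<pi> s)) < \<alpha>"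
  then obtain \<pi> where \<pi>: "(\<Sum>s\<in>UNIV. pmf p0 s * shortfall p r v s (\<pi> s)) < \<alpha>" ..
  \<comment> \<open>Half of the slack, so that the enlarged total remains strictly below \<open>\<alpha>\<close>.\<close>
  define \<epsilon> where "\<epsilon> = (\<alpha> - (\<Sum>s\<in>UNIV. pmf p0 s * shortfall p r v s (\<pi> s))) / 2"
  have "\<epsilon> > 0"
    using \<pi> by (simp add: \<epsilon>_def)
  define \<zeta> where "\<zeta> s = min 1 (shortfall p r v s (\<pi> s) + \<epsilon>)" for s
  have "(\<Sum>s\<in>UNIV. \<zeta> s * pmf p0 s) \<le> (\<Sum>s\<in>UNIV. (shortfall p r v s (\<pi> s) + \<epsilon>) * pmf p0 s)"
    unfolding \<zeta>_def by (intro sum_mono mult_right_mono) auto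
  also have "\<dots> = (\<Sum>s\<in>UNIV. pmf p0 s * shortfall p r v s (\<pi> s)) + \<epsilon>"
    by (simp add: algebra_simps sum.distrib sum_distrib_left[symmetric] sum_pmf_eq_1)
  also have "\<dots> < \<alpha>"
    using \<pi> by (simp add: \<epsilon>_def field_simps)
  finally have "\<zeta> \<in> feasible_levels p0 \<alpha>"
    using \<open>\<epsilon> > 0\<close> shortfall_nonneg[of p r v _ "\<pi> _"]
    by (auto simp: feasible_levels_def \<zeta>_def add_nonneg_nonneg)
  moreover have "shortfall p r v s (\<pi> s) < \<zeta> s" if "\<zeta> s < 1" for s
    using that \<open>\<epsilon> > 0\<close> by (auto simp: \<zeta>_def min_def split: if_splits)
  ultimately show "\<exists>\<zeta>\<in>feasible_levels p0 \<alpha>. \<forall>s. \<zeta> s < 1 \<longrightarrow> (\<exists>d. shortfall p r v s d < \<zeta> s)"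
    by blast
next
  assume "\<exists>\<zeta>\<in>feasible_levels p0 \<alpha>. \<forall>s. \<zeta> s < 1 \<longrightarrow> (\<exists>d. shortfall p r v s d < \<zeta> s)"
  then obtain \<zeta> where feas: "\<zeta> \<in> feasible_levels p0 \<alpha>"
    and "\<forall>s. \<exists>d. \<zeta> s < 1 \<longrightarrow> shortfall p r v s d < \<zeta> s"
    by blast
  then obtain \<pi> where \<pi>: "\<And>s. \<zeta> s < 1 \<Longrightarrow> shortfall p r v s (\<pi> s) < \<zeta> s"
    by metis
  \<comment> \<open>Where \<open>\<zeta> s = 1\<close>, the action law is arbitrary and the bound is that of a probability.\<close>
  have "shortfall p r v s (\<pi> s) \<le> \<zeta> s" for s
    using \<pi>[of s] shortfall_le_1[of p r v s "\<pi> s"] by linarith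
  then have "(\<Sum>s\<in>UNIV. pmf p0 s * shortfall p r v s (\<pi> s)) \<le> (\<Sum>s\<in>UNIV. \<zeta> s * pmf p0 s)"
    by (intro sum_mono) (metis mult.commute mult_left_mono pmf_nonneg)
  with feas show "\<exists>\<pi>. (\<Sum>s\<in>UNIV. pmf p0 s * shortfall p r v s (\<pi> s)) < \<alpha>"
    by (auto simp: feasible_levels_def intro: le_less_trans)
qed

theorem proposition5p3:
  fixes p :: "'s::finite \<Rightarrow> 'a::finite \<Rightarrow> 's pmf"
    and r :: "'s \<Rightarrow> 'a \<Rightarrow> 's \<Rightarrow> real"
    and p0 :: "'s pmf"
    and \<alpha> :: real
  assumes "\<forall>s. pmf p0 s > 0"
    and "\<alpha> \<in> {0..1}"
  shows
    "(\<exists>\<pi>. policy_quantile p0 p r \<alpha> \<pi> = (SUP \<pi>'. policy_quantile p0 p r \<alpha> \<pi>')) \<and>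
     (\<forall>\<zeta>\<in>feasible_levels p0 \<alpha>. {s. \<zeta> s < 1} \<noteq> {} \<and>
        (\<forall>s. \<zeta> s < 1 \<longrightarrow>
           (\<exists>d. state_quantile p0 p r (\<zeta> s) s d = (SUP d'. state_quantile p0 p r (\<zeta> s) s d')))) \<and>
     (SUP \<pi>. policy_quantile p0 p r \<alpha> \<pi>) =
       (SUP \<zeta>\<in>feasible_levels p0 \<alpha>.
          MIN s\<in>{s. \<zeta> s < 1}. SUP d. state_quantile p0 p r (\<zeta> s) s d)"
proof -
  let ?L = "SUP \<pi>. policy_quantile p0 p r \<alpha> \<pi>"
  let ?U = "\<lambda>\<zeta> s. SUP d. state_quantile p0 p r (\<zeta> s) s d"
  let ?m = "\<lambda>\<zeta>. MIN s\<in>{s. \<zeta> s < 1}. ?U \<zeta> s"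
  have pos: "\<And>s. pmf p0 s > 0"
    using assms by blast
  have nonempty: "{s. \<zeta> s < 1} \<noteq> {}" if "\<zeta> \<in> feasible_levels p0 \<alpha>" for \<zeta>
    using feasible_levels_ex_less_1[OF _ that] assms by simp
  have L_iff: "ereal v \<le> ?L \<longleftrightarrow> (\<exists>\<pi>. ereal v \<le> policy_quantile p0 p r \<alpha> \<pi>)" for v
    using policy_quantile_SUP_attained[of p0 p r \<alpha>] by (metis SUP_upper2 UNIV_I)
  have U_iff: "ereal v \<le> ?U \<zeta> s \<longleftrightarrow> (\<exists>d. ereal v \<le> state_quantile p0 p r (\<zeta> s) s d)" for v \<zeta> s
    using state_quantile_SUP_attained[of p0 p r "\<zeta> s" s] by (metis SUP_upper2 UNIV_I)
  have m_iff: "ereal v \<le> ?m \<zeta> \<longleftrightarrow> (\<forall>s. \<zeta> s < 1 \<longrightarrow> ereal v \<le> ?U \<zeta> s)"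
    if "\<zeta> \<in> feasible_levels p0 \<alpha>" for v \<zeta>
    using nonempty[OF that] by (subst Min_ge_iff) auto
  have key: "ereal v \<le> ?L \<longleftrightarrow> (\<exists>\<zeta>\<in>feasible_levels p0 \<alpha>. ereal v \<le> ?m \<zeta>)" for v
    unfolding L_iff ex_policy_iff_ex_feasible_levels[OF pos] using m_iff U_iff by simp
  \<comment> \<open>Testing with real \<open>v\<close> also covers the value \<open>-\<infinity>\<close>, which has no real lower bound.\<close>
  have "?L = (SUP \<zeta>\<in>feasible_levels p0 \<alpha>. ?m \<zeta>)"
  proof (rule antisym)
    show "?L \<le> (SUP \<zeta>\<in>feasible_levels p0 \<alpha>. ?m \<zeta>)"
    proof (rule ereal_leI_real_below)
      show "\<And>v. ereal v \<le> ?L \<Longrightarrow> ereal v \<le> (SUP \<zeta>\<in>feasible_levels p0 \<alpha>. ?m \<zeta>)"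
        using key by (blast intro: SUP_upper2)
    qed
    show "(SUP \<zeta>\<in>feasible_levels p0 \<alpha>. ?m \<zeta>) \<le> ?L"
    proof (rule SUP_least)
      fix \<zeta> assume feas: "\<zeta> \<in> feasible_levels p0 \<alpha>"
      show "?m \<zeta> \<le> ?L"
      proof (rule ereal_leI_real_below)
        fix v assume "ereal v \<le> ?m \<zeta>"
        with feas show "ereal v \<le> ?L"
          by (intro key[THEN iffD2] bexI)
      qed
    qed
  qed
  moreover have "\<exists>\<pi>. policy_quantile p0 p r \<alpha> \<pi> = ?L"
    by (rule policy_quantile_SUP_attained)
  moreover have "\<exists>d. state_quantile p0 p r (\<zeta> s) s d = ?U \<zeta> s" for \<zeta> s
    by (rule state_quantile_SUP_attained)
  ultimately show ?thesis
    using nonempty by (intro conjI ballI allI impI)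
qed

end
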